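(* Let $X$ be any diffeological space. The Klein stratification of $X$, that is, the partition of $X$ into the transitivity components (orbits) of its Klein groupoid $K\ell(X)$, satisfies the frontier condition with respect to the D-topology of $X$: for any two Klein strata $S$ and $S'$, if $S \cap \overline{S'} \neq \varnothing$ then $S \subset \overline{S'}$, where $\overline{S'}$ denotes the closure of $S'$ in the D-topology. In other words, the Klein stratification is a basic stratification of $X$.
   Context: A diffeological space is a set $X$ with a diffeology: a set of maps $P : U \to X$, called plots, defined on open subsets $U$ of $\mathbf{R}^n$ for all $n \ge 0$, which contains the constant maps, is local (a map $U\to X$ which is locally a plot around every point of $U$ is a plot), and is stable under precomposition with smooth maps between open subsets of Euclidean spaces. The D-topology of $X$ is the finest topology making all plots continuous: $A \subset X$ is D-open if and only if $P^{-1}(A)$ is open for every plot $P$. A local smooth map $f$ from $X$ to $X$ is a map defined on a D-open subset $A \subset X$ such that, for every plot $P$ of $X$, the map $f \circ P$ restricted to $P^{-1}(A)$ is a plot of $X$. A local diffeomorphism of $X$ is an injective local smooth map $\varphi$ defined on a D-open subset $\mathrm{dom}(\varphi)$ such that $\varphi(\mathrm{dom}(\varphi))$ is D-open and $\varphi^{-1}$, defined on $\varphi(\mathrm{dom}(\varphi))$, is a local smooth map. The set of local diffeomorphisms is denoted $\mathrm{Diff}_{\mathrm{loc}}(X)$. The Klein groupoid $K\ell(X)$ has the points of $X$ as its objects and $\mathrm{Mor}(K\ell(X)) = \{\mathrm{germ}(\varphi)_x \mid \varphi \in \mathrm{Diff}_{\mathrm{loc}}(X),\ x \in \mathrm{dom}(\varphi)\}$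 as its morphisms, with $\mathrm{src}(\mathrm{germ}(\varphi)_x) = x$, $\mathrm{trg}(\mathrm{germ}(\varphi)_x) = \varphi(x)$, and composition of germs. Two points $x, x'$ lie in the same transitivity component (Klein stratum) if and only if there is $\varphi \in \mathrm{Diff}_{\mathrm{loc}}(X)$ with $x \in \mathrm{dom}(\varphi)$ and $\varphi(x) = x'$. A basic stratification of a topological space is a partition of the space satisfying the frontier condition stated in the claim. *)

theory Defs
  imports "HOL-Analysis.Analysis" "HOL-Library.Disjoint_Sets"
begin

section \<open>Smooth maps between open subsets of Euclidean spaces\<close>

text \<open>
  The dimension has to vary inside the definition of a diffeology, so \<open>R^n\<close> is the library's
  \<^const>\<open>Euclidean_space\<close> \<open>n\<close>: the functions \<open>nat \<Rightarrow> real\<close> vanishing from index \<open>n\<close> on.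
  \<open>C_diff k m U f\<close> says that \<open>f\<close> is of class \<open>C^k\<close> on the open set \<open>U\<close> of \<open>R^m\<close>,
  by continuity of the iterated partial derivatives.
\<close>

primrec C_diff :: "nat \<Rightarrow> nat \<Rightarrow> (nat \<Rightarrow> real) set \<Rightarrow> ((nat \<Rightarrow> real) \<Rightarrow> real) \<Rightarrow> bool" where
  "C_diff 0 m U f \<longleftrightarrow> continuous_map (subtopology (Euclidean_space m) U) euclideanreal f"
| "C_diff (Suc k) m U f \<longleftrightarrow>
     continuous_map (subtopology (Euclidean_space m) U) euclideanreal f \<and>
     (\<forall>i<m. \<exists>g. (\<forall>x\<in>U. ((\<lambda>t. f (x(i := t))) has_real_derivative g x) (at (x i))) \<and> C_diff k m U g)"

definition smooth_map :: "nat \<Rightarrow> (nat \<Rightarrow> real) set \<Rightarrow> nat \<Rightarrow> (nat \<Rightarrow> real) set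
    \<Rightarrow> ((nat \<Rightarrow> real) \<Rightarrow> (nat \<Rightarrow> real)) \<Rightarrow> bool" where
  "smooth_map m V n U F \<longleftrightarrow>
     openin (Euclidean_space m) V \<and> openin (Euclidean_space n) U \<and> F ` V \<subseteq> U \<and>
     (\<forall>j<n. \<forall>k. C_diff k m V (\<lambda>x. F x j))"


section \<open>Diffeological spaces\<close>

text \<open>
  A map defined on a subset is a partial function, whose domain of definition is \<^const>\<open>dom\<close>
  and whose image is \<^const>\<open>ran\<close>; \<open>plots n\<close> is the set of plots defined on open subsets of \<open>R^n\<close>.
\<close>

locale diffeological_space =
  fixes X :: "'a set" and plots :: "nat \<Rightarrow> ((nat \<Rightarrow> real) \<rightharpoonup> 'a) set"
  assumes plot_dom: "P \<in> plots n \<Longrightarrow> openin (Euclidean_space n) (dom P)"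
    and plot_ran: "P \<in> plots n \<Longrightarrow> ran P \<subseteq> X"
    and plot_const: "\<lbrakk>openin (Euclidean_space n) U; c \<in> X\<rbrakk> \<Longrightarrow> (\<lambda>_. Some c) |` U \<in> plots n"
    and plot_local: "\<lbrakk>openin (Euclidean_space n) (dom P); ran P \<subseteq> X;
          \<And>x. x \<in> dom P \<Longrightarrow>
            \<exists>V. openin (Euclidean_space n) V \<and> x \<in> V \<and> V \<subseteq> dom P \<and> P |` V \<in> plots n\<rbrakk>
        \<Longrightarrow> P \<in> plots n"
    and plot_smooth: "\<lbrakk>P \<in> plots n; smooth_map m V n (dom P) F\<rbrakk> \<Longrightarrow> (P \<circ> F) |` V \<in> plots m"

definition D_open :: "'a set \<Rightarrow> (nat \<Rightarrow> ((nat \<Rightarrow> real) \<rightharpoonup> 'a) set) \<Rightarrow> 'a set \<Rightarrow> bool" where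
  "D_open X plots A \<longleftrightarrow>
     A \<subseteq> X \<and> (\<forall>n. \<forall>P\<in>plots n. openin (Euclidean_space n) {r. \<exists>a\<in>A. P r = Some a})"

definition D_topology :: "'a set \<Rightarrow> (nat \<Rightarrow> ((nat \<Rightarrow> real) \<rightharpoonup> 'a) set) \<Rightarrow> 'a topology" where
  "D_topology X plots = topology (D_open X plots)"

lemma openin_D_topology: "openin (D_topology X plots) = D_open X plots"
proof -
  have "D_open X plots (S \<inter> T)" if S: "D_open X plots S" and T: "D_open X plots T" for S T
  proof -
    have "{r. \<exists>a\<in>S \<inter> T. P r = Some a} = {r. \<exists>a\<in>S. P r = Some a} \<inter> {r. \<exists>a\<in>T. P r = Some a}"
      for P :: "(nat \<Rightarrow> real) \<rightharpoonup> 'a"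
      by auto
    with S T show ?thesis
      unfolding D_open_def by auto
  qed
  moreover have "D_open X plots (\<Union>\<K>)" if K: "\<forall>S\<in>\<K>. D_open X plots S" for \<K>
  proof -
    have "{r. \<exists>a\<in>\<Union>\<K>. P r = Some a} = (\<Union>S\<in>\<K>. {r. \<exists>a\<in>S. P r = Some a})"
      for P :: "(nat \<Rightarrow> real) \<rightharpoonup> 'a"
      by auto
    with K show ?thesis
      unfolding D_open_def by auto
  qed
  ultimately have "istopology (D_open X plots)"
    unfolding istopology_def by blast
  then show ?thesis
    by (simp add: D_topology_def)
qed

lemma (in diffeological_space) topspace_D_topology: "topspace (D_topology X plots) = X"
proof -
  have "{r. \<exists>a\<in>X. P r = Some a} = dom P" if "P \<in> plots n" for P n
    using plot_ran[OF that] by (auto simp: ran_def)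
  then have "D_open X plots X"
    by (auto simp: D_open_def plot_dom)
  then show ?thesis
    unfolding topspace_def openin_D_topology by (auto simp: D_open_def)
qed


section \<open>Local diffeomorphisms\<close>

text \<open>For a plot \<open>P\<close>, \<open>f \<circ>\<^sub>m P\<close> is the composite of \<open>f\<close> and \<open>P\<close> defined on the preimage of \<open>dom f\<close>.\<close>

definition local_smooth :: "'a set \<Rightarrow> (nat \<Rightarrow> ((nat \<Rightarrow> real) \<rightharpoonup> 'a) set) \<Rightarrow> ('a \<rightharpoonup> 'a) \<Rightarrow> bool" where
  "local_smooth X plots f \<longleftrightarrow>
     openin (D_topology X plots) (dom f) \<and> ran f \<subseteq> X \<and> (\<forall>n. \<forall>P\<in>plots n. f \<circ>\<^sub>m P \<in> plots n)"

definition partial_inv :: "('a \<rightharpoonup> 'b) \<Rightarrow> ('b \<rightharpoonup> 'a)" where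
  "partial_inv f = (\<lambda>y. if y \<in> ran f then Some (THE x. f x = Some y) else None)"

definition Diff_loc :: "'a set \<Rightarrow> (nat \<Rightarrow> ((nat \<Rightarrow> real) \<rightharpoonup> 'a) set) \<Rightarrow> ('a \<rightharpoonup> 'a) set" where
  "Diff_loc X plots =
     {\<phi>. local_smooth X plots \<phi> \<and> inj_on \<phi> (dom \<phi>) \<and>
          openin (D_topology X plots) (ran \<phi>) \<and> local_smooth X plots (partial_inv \<phi>)}"


section \<open>The Klein groupoid and its strata\<close>

text \<open>
  The base point is part of a germ: it cannot be recovered from the equivalence class of maps
  when the D-topology does not separate points (for instance, for a coarse diffeology).
\<close>

type_synonym 'a germ = "'a \<times> ('a \<rightharpoonup> 'a) set"

definition germ :: "'a set \<Rightarrow> (nat \<Rightarrow> ((nat \<Rightarrow> real) \<rightharpoonup> 'a) set) \<Rightarrow> ('a \<rightharpoonup> 'a) \<Rightarrow> 'a \<Rightarrow> 'a germ" where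
  "germ X plots \<phi> x =
     (x, {\<psi>. local_smooth X plots \<psi> \<and>
             (\<exists>W. openin (D_topology X plots) W \<and> x \<in> W \<and> W \<subseteq> dom \<phi> \<and> W \<subseteq> dom \<psi> \<and>
                  (\<forall>z\<in>W. \<psi> z = \<phi> z))})"

definition germ_src :: "'a germ \<Rightarrow> 'a" where
  "germ_src \<gamma> = fst \<gamma>"

definition germ_trg :: "'a germ \<Rightarrow> 'a" where
  "germ_trg \<gamma> = (THE y. \<exists>\<psi>\<in>snd \<gamma>. \<psi> (fst \<gamma>) = Some y)"

text \<open>\<open>germ_comp X plots \<delta> \<gamma>\<close> is \<open>\<delta>\<close> after \<open>\<gamma>\<close>, meaningful when \<open>germ_src \<delta> = germ_trg \<gamma>\<close>.\<close>

definition germ_comp :: "'a set \<Rightarrow> (nat \<Rightarrow> ((nat \<Rightarrow> real) \<rightharpoonup> 'a) set)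
    \<Rightarrow> 'a germ \<Rightarrow> 'a germ \<Rightarrow> 'a germ" where
  "germ_comp X plots \<delta> \<gamma> =
     (fst \<gamma>, \<Union>\<phi>\<in>snd \<gamma>. \<Union>\<psi>\<in>snd \<delta>. snd (germ X plots (\<psi> \<circ>\<^sub>m \<phi>) (fst \<gamma>)))"

record ('o, 'm) groupoid =
  Obj :: "'o set"
  Mor :: "'m set"
  src :: "'m \<Rightarrow> 'o"
  trg :: "'m \<Rightarrow> 'o"
  cmp :: "'m \<Rightarrow> 'm \<Rightarrow> 'm"

definition transitivity_component :: "('o, 'm) groupoid \<Rightarrow> 'o \<Rightarrow> 'o set" where
  "transitivity_component G x = {y \<in> Obj G. \<exists>\<gamma>\<in>Mor G. src G \<gamma> = x \<and> trg G \<gamma> = y}"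

definition transitivity_components :: "('o, 'm) groupoid \<Rightarrow> 'o set set" where
  "transitivity_components G = transitivity_component G ` Obj G"

definition Klein_groupoid ::
    "'a set \<Rightarrow> (nat \<Rightarrow> ((nat \<Rightarrow> real) \<rightharpoonup> 'a) set) \<Rightarrow> ('a, 'a germ) groupoid" where
  "Klein_groupoid X plots =
     \<lparr>Obj = X,
      Mor = {germ X plots \<phi> x | \<phi> x. \<phi> \<in> Diff_loc X plots \<and> x \<in> dom \<phi>},
      src = germ_src,
      trg = germ_trg,
      cmp = germ_comp X plots\<rparr>"

definition Klein_strata :: "'a set \<Rightarrow> (nat \<Rightarrow> ((nat \<Rightarrow> real) \<rightharpoonup> 'a) set) \<Rightarrow> 'a set set" where
  "Klein_strata X plots = transitivity_components (Klein_groupoid X plots)"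


section \<open>Basic stratifications\<close>

definition frontier_condition :: "'a topology \<Rightarrow> 'a set set \<Rightarrow> bool" where
  "frontier_condition T \<S> \<longleftrightarrow>
     (\<forall>S\<in>\<S>. \<forall>S'\<in>\<S>. S \<inter> (T closure_of S') \<noteq> {} \<longrightarrow> S \<subseteq> T closure_of S')"

definition basic_stratification :: "'a topology \<Rightarrow> 'a set set \<Rightarrow> bool" where
  "basic_stratification T \<S> \<longleftrightarrow> partition_on (topspace T) \<S> \<and> frontier_condition T \<S>"

end

theory Submission
  imports Defs
begin

text \<open>
  A local diffeomorphism \<open>\<phi>\<close> is a homeomorphism between D-open sets and maps each Klein orbit into
  itself. So if \<open>\<phi>\<close> carries \<open>x\<close> to \<open>y\<close> and \<open>x\<close> adheres to a stratum \<open>S'\<close>, then \<open>y\<close> adheres to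
  \<open>S'\<close> as well: pull a D-open neighbourhood of \<open>y\<close> back along \<open>\<phi>\<close> to a D-open neighbourhood of \<open>x\<close>
  (\<open>local_smooth_preimage\<close>), pick a point of \<open>S'\<close> there, and push it forward; the image is still in
  the orbit \<open>S'\<close> (\<open>closure_Klein_stratum_invariant\<close>). Since a stratum \<open>S\<close> is a single orbit, one
  point of \<open>S\<close> in the closure of \<open>S'\<close> drags all of \<open>S\<close> along.

  That the strata form a partition amounts to local diffeomorphisms being closed under identity,
  inverse and composition (\<open>equiv_Klein_rel\<close>). The target of a germ does not depend on the
  representative, so the strata are the classes of the relation "carried to by a local
  diffeomorphism", and germs disappear from the argument (\<open>Klein_strata_eq_quotient\<close>).
\<close>

section \<open>Local diffeomorphisms as mutually inverse local smooth maps\<close>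

text \<open>
  Replacing \<open>partial_inv\<close> by an unspecified relational inverse makes the description symmetric in
  the two maps, so that inverses come for free and composites are easy to invert.
\<close>

lemma Diff_loc_iff_inverse:
  "\<phi> \<in> Diff_loc X plots \<longleftrightarrow>
     (\<exists>\<psi>. local_smooth X plots \<phi> \<and> local_smooth X plots \<psi> \<and>
          (\<forall>x y. \<phi> x = Some y \<longleftrightarrow> \<psi> y = Some x))"
proof
  assume "\<phi> \<in> Diff_loc X plots"
  then have smooth: "local_smooth X plots \<phi>" "local_smooth X plots (partial_inv \<phi>)"
    and inj: "inj_on \<phi> (dom \<phi>)"
    by (auto simp: Diff_loc_def)
  have the_eq: "(THE x. \<phi> x = Some y) = x" if "\<phi> x = Some y" for x y
    using that by (intro the_equality inj_onD[OF inj]) auto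
  have "\<phi> x = Some y \<longleftrightarrow> partial_inv \<phi> y = Some x" for x y
  proof
    assume "\<phi> x = Some y"
    then show "partial_inv \<phi> y = Some x"
      by (auto simp: partial_inv_def the_eq ranI)
  next
    assume y: "partial_inv \<phi> y = Some x"
    then obtain z where z: "\<phi> z = Some y"
      by (auto simp: partial_inv_def ran_def split: if_splits)
    with y the_eq have "z = x"
      by (auto simp: partial_inv_def ranI)
    with z show "\<phi> x = Some y"
      by simp
  qed
  with smooth show "\<exists>\<psi>. local_smooth X plots \<phi> \<and> local_smooth X plots \<psi> \<and>
      (\<forall>x y. \<phi> x = Some y \<longleftrightarrow> \<psi> y = Some x)"
    by blast
next
  assume "\<exists>\<psi>. local_smooth X plots \<phi> \<and> local_smooth X plots \<psi> \<and>
      (\<forall>x y. \<phi> x = Some y \<longleftrightarrow> \<psi> y = Some x)"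
  then obtain \<psi> where smooth: "local_smooth X plots \<phi>" "local_smooth X plots \<psi>"
    and inv: "\<And>x y. \<phi> x = Some y \<longleftrightarrow> \<psi> y = Some x"
    by blast
  have ran: "ran \<phi> = dom \<psi>"
    by (auto simp: ran_def dom_def inv)
  have "partial_inv \<phi> y = \<psi> y" for y
    unfolding partial_inv_def ran by (cases "\<psi> y") (auto simp: inv)
  then have "partial_inv \<phi> = \<psi>" ..
  moreover have "inj_on \<phi> (dom \<phi>)"
    by (rule inj_onI) (auto simp: inv)
  ultimately show "\<phi> \<in> Diff_loc X plots"
    using smooth ran by (simp add: Diff_loc_def local_smooth_def)
qed

text \<open>D-continuity: the D-topology is tested on plots, and \<open>f \<circ>\<^sub>m P\<close> is again a plot.\<close>

lemma local_smooth_preimage: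
  assumes f: "local_smooth X plots f" and B: "openin (D_topology X plots) B"
  shows "openin (D_topology X plots) {x. \<exists>b\<in>B. f x = Some b}"
proof -
  have "{x. \<exists>b\<in>B. f x = Some b} \<subseteq> X"
    using f by (auto simp: local_smooth_def openin_D_topology D_open_def)
  moreover have "openin (Euclidean_space n) {r. \<exists>a\<in>{x. \<exists>b\<in>B. f x = Some b}. P r = Some a}"
    if P: "P \<in> plots n" for n P
  proof -
    have "{r. \<exists>a\<in>{x. \<exists>b\<in>B. f x = Some b}. P r = Some a} = {r. \<exists>b\<in>B. (f \<circ>\<^sub>m P) r = Some b}"
      by (auto simp: map_comp_Some_iff)
    moreover have "f \<circ>\<^sub>m P \<in> plots n"
      using f P by (auto simp: local_smooth_def)
    ultimately show ?thesis
      using B by (simp add: openin_D_topology D_open_def)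
  qed
  ultimately show ?thesis
    by (simp add: openin_D_topology D_open_def)
qed

lemma local_smooth_comp:
  assumes f: "local_smooth X plots f" and g: "local_smooth X plots g"
  shows "local_smooth X plots (g \<circ>\<^sub>m f)"
proof -
  have "dom (g \<circ>\<^sub>m f) = {x. \<exists>b\<in>dom g. f x = Some b}"
    by (auto simp: dom_def map_comp_Some_iff)
  then have "openin (D_topology X plots) (dom (g \<circ>\<^sub>m f))"
    using local_smooth_preimage[OF f] g by (simp add: local_smooth_def)
  moreover have "ran (g \<circ>\<^sub>m f) \<subseteq> X"
    using g by (auto simp: local_smooth_def ran_def map_comp_Some_iff)
  moreover have "(g \<circ>\<^sub>m f) \<circ>\<^sub>m P \<in> plots n" if P: "P \<in> plots n" for n P
  proof -
    have "(g \<circ>\<^sub>m f) \<circ>\<^sub>m P = g \<circ>\<^sub>m (f \<circ>\<^sub>m P)"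
      by (auto simp: map_comp_def split: option.split)
    then show ?thesis
      using f g P by (simp add: local_smooth_def)
  qed
  ultimately show ?thesis
    by (simp add: local_smooth_def)
qed

lemma (in diffeological_space) local_smooth_id: "local_smooth X plots (Some |` X)"
proof -
  have "Some |` X \<circ>\<^sub>m P = P" if "P \<in> plots n" for P n
  proof
    fix r
    show "(Some |` X \<circ>\<^sub>m P) r = P r"
      using plot_ran[OF that] by (cases "P r") (auto simp: map_comp_def ran_def)
  qed
  moreover have "openin (D_topology X plots) (dom (Some |` X))"
    using openin_topspace[of "D_topology X plots"]
    by (simp add: topspace_D_topology dom_def restrict_map_def)
  ultimately show ?thesis
    by (auto simp: local_smooth_def ran_def restrict_map_def split: if_splits)
qed

lemma (in diffeological_space) Diff_loc_id: "Some |` X \<in> Diff_loc X plots"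
  unfolding Diff_loc_iff_inverse
proof (intro exI[of _ "Some |` X"] conjI allI local_smooth_id)
  fix x y
  show "(Some |` X) x = Some y \<longleftrightarrow> (Some |` X) y = Some x"
    by (auto simp: restrict_map_def)
qed

lemma Diff_loc_comp:
  assumes "\<phi> \<in> Diff_loc X plots" "\<psi> \<in> Diff_loc X plots"
  shows "\<psi> \<circ>\<^sub>m \<phi> \<in> Diff_loc X plots"
proof -
  from assms obtain \<phi>' \<psi>' where
    "local_smooth X plots \<phi>" "local_smooth X plots \<phi>'"
    "local_smooth X plots \<psi>" "local_smooth X plots \<psi>'"
    and inv: "\<And>x y. \<phi> x = Some y \<longleftrightarrow> \<phi>' y = Some x" "\<And>x y. \<psi> x = Some y \<longleftrightarrow> \<psi>' y = Some x"
    unfolding Diff_loc_iff_inverse by blast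
  then have "local_smooth X plots (\<psi> \<circ>\<^sub>m \<phi>)" "local_smooth X plots (\<phi>' \<circ>\<^sub>m \<psi>')"
    by (simp_all add: local_smooth_comp)
  moreover have "(\<psi> \<circ>\<^sub>m \<phi>) x = Some y \<longleftrightarrow> (\<phi>' \<circ>\<^sub>m \<psi>') y = Some x" for x y
    by (auto simp: map_comp_Some_iff inv)
  ultimately show ?thesis
    unfolding Diff_loc_iff_inverse by blast
qed


section \<open>Klein strata as equivalence classes\<close>

definition Klein_rel :: "'a set \<Rightarrow> (nat \<Rightarrow> ((nat \<Rightarrow> real) \<rightharpoonup> 'a) set) \<Rightarrow> 'a rel" where
  "Klein_rel X plots = {(x, y). \<exists>\<phi>\<in>Diff_loc X plots. \<phi> x = Some y}"

lemma Klein_rel_subset: "Klein_rel X plots \<subseteq> X \<times> X"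
proof (rule subrelI)
  fix x y assume "(x, y) \<in> Klein_rel X plots"
  then obtain \<phi> where "local_smooth X plots \<phi>" "\<phi> x = Some y"
    unfolding Klein_rel_def Diff_loc_def by blast
  then have "dom \<phi> \<subseteq> X" "ran \<phi> \<subseteq> X" "x \<in> dom \<phi>" "y \<in> ran \<phi>"
    by (auto simp: local_smooth_def openin_D_topology D_open_def intro: ranI)
  then show "(x, y) \<in> X \<times> X"
    by blast
qed

lemma (in diffeological_space) equiv_Klein_rel: "equiv X (Klein_rel X plots)"
proof (rule equivI)
  show "Klein_rel X plots \<subseteq> X \<times> X"
    by (rule Klein_rel_subset)
  show "refl_on X (Klein_rel X plots)"
  proof (rule refl_onI)
    fix x assume "x \<in> X"
    then have "(Some |` X) x = Some x"
      by simp
    with Diff_loc_id show "(x, x) \<in> Klein_rel X plots"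
      by (auto simp only: Klein_rel_def mem_Collect_eq prod.case)
  qed
  show "sym (Klein_rel X plots)"
  proof (rule symI)
    fix x y assume "(x, y) \<in> Klein_rel X plots"
    then obtain \<phi> \<psi> where "local_smooth X plots \<phi>" "local_smooth X plots \<psi>"
      "\<forall>x y. \<phi> x = Some y \<longleftrightarrow> \<psi> y = Some x" "\<phi> x = Some y"
      by (auto simp: Klein_rel_def Diff_loc_iff_inverse)
    then have "\<psi> \<in> Diff_loc X plots" "\<psi> y = Some x"
      unfolding Diff_loc_iff_inverse by (auto intro!: exI[of _ \<phi>])
    then show "(y, x) \<in> Klein_rel X plots"
      by (auto simp: Klein_rel_def)
  qed
  show "trans (Klein_rel X plots)"
  proof (rule transI)
    fix x y z assume "(x, y) \<in> Klein_rel X plots" "(y, z) \<in> Klein_rel X plots"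
    then obtain \<phi> \<psi> where "\<phi> \<in> Diff_loc X plots" "\<psi> \<in> Diff_loc X plots"
      and xz: "(\<psi> \<circ>\<^sub>m \<phi>) x = Some z"
      by (auto simp: Klein_rel_def map_comp_Some_iff)
    then have "\<psi> \<circ>\<^sub>m \<phi> \<in> Diff_loc X plots"
      by (simp add: Diff_loc_comp)
    with xz show "(x, z) \<in> Klein_rel X plots"
      unfolding Klein_rel_def by blast
  qed
qed

text \<open>
  The description in \<open>germ_trg\<close> is well defined: every representative of the germ agrees with \<open>\<phi>\<close>
  at \<open>x\<close>, and \<open>\<phi>\<close> itself is a representative, with its whole domain as neighbourhood.
\<close>

lemma germ_trg_germ:
  assumes "local_smooth X plots \<phi>" "\<phi> x = Some y"
  shows "germ_trg (germ X plots \<phi> x) = y"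
proof -
  have rep: "\<phi> \<in> snd (germ X plots \<phi> x)"
    using assms by (auto simp: germ_def local_smooth_def intro!: exI[of _ "dom \<phi>"])
  have agree: "\<psi> x = Some y" if "\<psi> \<in> snd (germ X plots \<phi> x)" for \<psi>
    using that assms(2) by (auto simp: germ_def)
  have base: "fst (germ X plots \<phi> x) = x"
    by (simp add: germ_def)
  show ?thesis
    unfolding germ_trg_def base
  proof (rule the_equality)
    show "\<exists>\<psi>\<in>snd (germ X plots \<phi> x). \<psi> x = Some y"
      using assms(2) rep by (rule bexI)
  next
    fix y' assume "\<exists>\<psi>\<in>snd (germ X plots \<phi> x). \<psi> x = Some y'"
    then obtain \<psi> where "\<psi> \<in> snd (germ X plots \<phi> x)" "\<psi> x = Some y'" ..
    with agree[of \<psi>] show "y' = y"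
      by simp
  qed
qed

lemma transitivity_component_Klein:
  "transitivity_component (Klein_groupoid X plots) x = Klein_rel X plots `` {x}"
proof -
  have trg: "germ_trg (germ X plots \<phi> z) = the (\<phi> z)"
    if "\<phi> \<in> Diff_loc X plots" "z \<in> dom \<phi>" for \<phi> z
    using that germ_trg_germ[of X plots \<phi> z] by (auto simp: Diff_loc_def)
  have src: "germ_src (germ X plots \<phi> z) = z" for \<phi> z
    by (simp add: germ_src_def germ_def)
  have mor: "Mor (Klein_groupoid X plots) =
      {germ X plots \<phi> z | \<phi> z. \<phi> \<in> Diff_loc X plots \<and> z \<in> dom \<phi>}"
    and maps: "Obj (Klein_groupoid X plots) = X"
      "src (Klein_groupoid X plots) = germ_src"
      "trg (Klein_groupoid X plots) = germ_trg"
    by (simp_all add: Klein_groupoid_def)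
  show ?thesis
  proof (intro set_eqI iffI)
    fix y assume "y \<in> transitivity_component (Klein_groupoid X plots) x"
    then obtain \<gamma> where \<gamma>: "\<gamma> \<in> Mor (Klein_groupoid X plots)" "germ_src \<gamma> = x" "germ_trg \<gamma> = y"
      unfolding transitivity_component_def maps by blast
    from \<gamma>(1) obtain \<phi> z where \<phi>: "\<gamma> = germ X plots \<phi> z" "\<phi> \<in> Diff_loc X plots" "z \<in> dom \<phi>"
      unfolding mor by blast
    with \<gamma> have "\<phi> x = Some y"
      by (auto simp: src trg)
    with \<phi>(2) show "y \<in> Klein_rel X plots `` {x}"
      unfolding Klein_rel_def by blast
  next
    fix y assume y: "y \<in> Klein_rel X plots `` {x}"
    then obtain \<phi> where \<phi>: "\<phi> \<in> Diff_loc X plots" "\<phi> x = Some y"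
      unfolding Klein_rel_def by blast
    then have "germ X plots \<phi> x \<in> Mor (Klein_groupoid X plots)"
      unfolding mor by blast
    moreover have "germ_trg (germ X plots \<phi> x) = y"
      using \<phi> trg[of \<phi> x] by (simp add: domI)
    moreover have "y \<in> X"
      using y Klein_rel_subset[of X plots] by blast
    ultimately show "y \<in> transitivity_component (Klein_groupoid X plots) x"
      unfolding transitivity_component_def maps using src by blast
  qed
qed

lemma Klein_strata_eq_quotient: "Klein_strata X plots = X // Klein_rel X plots"
proof -
  have "Obj (Klein_groupoid X plots) = X"
    by (simp add: Klein_groupoid_def)
  then have "Klein_strata X plots = (\<lambda>x. Klein_rel X plots `` {x}) ` X"
    by (simp add: Klein_strata_def transitivity_components_def transitivity_component_Klein)
  then show ?thesis
    by (simp add: quotient_def UNION_singleton_eq_range)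
qed


section \<open>The frontier condition\<close>

lemma (in diffeological_space) closure_Klein_stratum_invariant:
  assumes S': "S' \<in> Klein_strata X plots"
    and x: "x \<in> D_topology X plots closure_of S'"
    and xy: "(x, y) \<in> Klein_rel X plots"
  shows "y \<in> D_topology X plots closure_of S'"
  unfolding in_closure_of
proof (intro conjI allI impI)
  show "y \<in> topspace (D_topology X plots)"
    using xy Klein_rel_subset[of X plots] unfolding topspace_D_topology by blast
  obtain \<phi> where \<phi>: "\<phi> \<in> Diff_loc X plots" "\<phi> x = Some y"
    using xy unfolding Klein_rel_def by blast
  fix W assume W: "y \<in> W \<and> openin (D_topology X plots) W"
  have "openin (D_topology X plots) {z. \<exists>w\<in>W. \<phi> z = Some w}"
    using \<phi> W by (intro local_smooth_preimage) (auto simp: Diff_loc_def)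
  moreover have "x \<in> {z. \<exists>w\<in>W. \<phi> z = Some w}"
    using \<phi> W by auto
  ultimately obtain z where "z \<in> S'" "z \<in> {z. \<exists>w\<in>W. \<phi> z = Some w}"
    using x unfolding in_closure_of by meson
  then obtain w where z: "z \<in> S'" "w \<in> W" "\<phi> z = Some w"
    by blast
  have "(z, w) \<in> Klein_rel X plots"
    using \<phi>(1) z(3) unfolding Klein_rel_def by blast
  then have "w \<in> S'"
    using in_quotient_imp_closed[OF equiv_Klein_rel S'[unfolded Klein_strata_eq_quotient] z(1)]
    by simp
  then show "\<exists>w. w \<in> S' \<and> w \<in> W"
    using z by blast
qed

theorem mainTheorem1:
  fixes X :: "'a set" and plots :: "nat \<Rightarrow> ((nat \<Rightarrow> real) \<rightharpoonup> 'a) set"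
  assumes "diffeological_space X plots"
  shows "(\<forall>S\<in>Klein_strata X plots. \<forall>S'\<in>Klein_strata X plots.
            S \<inter> (D_topology X plots closure_of S') \<noteq> {} \<longrightarrow>
            S \<subseteq> D_topology X plots closure_of S')
       \<and> basic_stratification (D_topology X plots) (Klein_strata X plots)"
proof -
  interpret diffeological_space X plots
    by (rule assms)
  have frontier: "S \<subseteq> D_topology X plots closure_of S'"
    if S: "S \<in> Klein_strata X plots" and S': "S' \<in> Klein_strata X plots"
      and meet: "S \<inter> (D_topology X plots closure_of S') \<noteq> {}" for S S'
  proof
    fix y assume y: "y \<in> S"
    from meet obtain x where x: "x \<in> S" "x \<in> D_topology X plots closure_of S'"
      by blast
    have "(x, y) \<in> Klein_rel X plots"
      using quotient_eq_iff[OF equiv_Klein_rel] S x(1) y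
      unfolding Klein_strata_eq_quotient by blast
    with S' x(2) show "y \<in> D_topology X plots closure_of S'"
      by (rule closure_Klein_stratum_invariant)
  qed
  moreover have "partition_on (topspace (D_topology X plots)) (Klein_strata X plots)"
    by (simp add: topspace_D_topology Klein_strata_eq_quotient partition_on_quotient
        equiv_Klein_rel)
  ultimately show ?thesis
    by (auto simp: basic_stratification_def frontier_condition_def)
qed

end
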